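(* Fix an integer $c\ge 2$. There exists $K$ such that for every integer $k\ge K$, putting $x=p_{c(k-1)}-1$ (where $p_m$ is the $m$-th prime, $p_1=2$), there is a coloring of $\{1,\ldots,x\}$ with $c$ colors in which every color class has size $\lfloor x/c\rfloor$ or $\lceil x/c\rceil$ and no color class contains $k$ pairwise coprime integers. Consequently, if $L_{\mathrm{bal}}(k;c)$ denotes the largest $n$ admitting a $c$-coloring of $\{1,\ldots,n\}$ with all color class sizes in $\{\lfloor n/c\rfloor,\lceil n/c\rceil\}$ and no color class containing $k$ pairwise coprime integers, then $L_{\mathrm{bal}}(k;c)=p_{c(k-1)}-1$ for all sufficiently large $k$.
   Context: A set of pairwise coprime integers means a set of distinct positive integers any two of which have greatest common divisor $1$. *)

theory Defs
  imports Complex_Main "HOL-Library.Infinite_Set" "HOL-Library.FuncSet"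
    "HOL-Computational_Algebra.Primes"
begin

(* Indexed from 1: nth_prime 1 = 2.  The value at 0 is immaterial. *)
definition nth_prime :: "nat \<Rightarrow> nat" where
  "nth_prime m = enumerate {p. prime p} (m - 1)"

definition color_class :: "(nat \<Rightarrow> nat) \<Rightarrow> nat \<Rightarrow> nat \<Rightarrow> nat set" where
  "color_class f n i = {a \<in> {1..n}. f a = i}"

definition contains_pairwise_coprime :: "nat set \<Rightarrow> nat \<Rightarrow> bool" where
  "contains_pairwise_coprime A k \<longleftrightarrow>
     (\<exists>S\<subseteq>A. finite S \<and> card S = k \<and> (\<forall>a\<in>S. \<forall>b\<in>S. a \<noteq> b \<longrightarrow> gcd a b = 1))"

definition balanced_coloring :: "nat \<Rightarrow> nat \<Rightarrow> (nat \<Rightarrow> nat) \<Rightarrow> bool" where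
  "balanced_coloring c n f \<longleftrightarrow>
     f \<in> {1..n} \<rightarrow> {..<c} \<and>
     (\<forall>i<c. int (card (color_class f n i)) \<in> {\<lfloor>real n / real c\<rfloor>, \<lceil>real n / real c\<rceil>})"

definition good_balanced_coloring :: "nat \<Rightarrow> nat \<Rightarrow> nat \<Rightarrow> (nat \<Rightarrow> nat) \<Rightarrow> bool" where
  "good_balanced_coloring k c n f \<longleftrightarrow>
     balanced_coloring c n f \<and>
     (\<forall>i<c. \<not> contains_pairwise_coprime (color_class f n i) k)"

definition L_bal :: "nat \<Rightarrow> nat \<Rightarrow> nat" where
  "L_bal k c = (GREATEST n. \<exists>f. good_balanced_coloring k c n f)"

text \<open>
  The maximum defining \<open>L_bal\<close> exists whenever \<open>k \<ge> 1\<close>, so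
  the \<open>GREATEST\<close> operator never returns an unspecified value there.
\<close>

lemma good_balanced_coloring_bounded:
  "\<exists>B. \<forall>n. (\<exists>f. good_balanced_coloring k c n f) \<longrightarrow> n \<le> B"
proof -
  obtain T :: "nat set" where T: "finite T" "card T = Suc (c * k)" "T \<subseteq> {p. prime p}"
    using infinite_arbitrarily_large[OF primes_infinite, of "Suc (c * k)"] by blast
  have "n \<le> Max T" if f: "good_balanced_coloring k c n f" for n f
  proof (rule ccontr)
    assume "\<not> n \<le> Max T"
    then have n: "Max T < n" by simp
    have T1: "T \<subseteq> {1..n}"
    proof
      fix p assume "p \<in> T"
      then have "p \<le> Max T" "prime p" using T(1,3) by auto
      then show "p \<in> {1..n}" using n prime_ge_1_nat[of p] by simp
    qed
    define U where "U i = {a \<in> T. f a = i}" for i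
    have "card (U i) \<le> k" if i: "i < c" for i
    proof (rule ccontr)
      assume "\<not> card (U i) \<le> k"
      then obtain S where S: "S \<subseteq> U i" "card S = k" "finite S"
        using obtain_subset_with_card_n[of k "U i"] by auto
      have "S \<subseteq> color_class f n i"
        using S(1) T1 unfolding U_def color_class_def by blast
      moreover have "gcd a b = 1" if "a \<in> S" "b \<in> S" "a \<noteq> b" for a b
      proof -
        have "prime a" "prime b" using that S(1) T(3) unfolding U_def by blast+
        then show ?thesis using primes_coprime that(3) coprime_iff_gcd_eq_1 by blast
      qed
      ultimately have "contains_pairwise_coprime (color_class f n i) k"
        using S unfolding contains_pairwise_coprime_def by blast
      then show False
        using f i unfolding good_balanced_coloring_def by blast
    qed
    moreover have "T = (\<Union>i<c. U i)"
      using f T1 unfolding U_def good_balanced_coloring_def balanced_coloring_def Pi_def by blast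
    moreover have "card (\<Union>i<c. U i) \<le> (\<Sum>i<c. card (U i))"
      by (rule card_UN_le) simp
    ultimately have "card T \<le> c * k"
      using sum_bounded_above[of "{..<c}" "\<lambda>i. card (U i)" k] by simp
    then show False using T by simp
  qed
  then show ?thesis by blast
qed

lemma L_bal_greatest:
  assumes "k \<ge> 1"
  shows "\<exists>f. good_balanced_coloring k c (L_bal k c) f"
    and "good_balanced_coloring k c n f \<Longrightarrow> n \<le> L_bal k c"
proof -
  obtain B where B: "\<And>n. \<exists>f. good_balanced_coloring k c n f \<Longrightarrow> n \<le> B"
    using good_balanced_coloring_bounded by blast
  have "good_balanced_coloring k c 0 (\<lambda>_. 0)"
    using assms by (auto simp: good_balanced_coloring_def balanced_coloring_def
        color_class_def contains_pairwise_coprime_def)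
  then have "\<exists>f. good_balanced_coloring k c 0 f" by (rule exI[of _ "\<lambda>_. 0"])
  then show "\<exists>f. good_balanced_coloring k c (L_bal k c) f"
    unfolding L_bal_def by (rule GreatestI_nat[OF _ B])
  show "n \<le> L_bal k c" if "good_balanced_coloring k c n f"
    unfolding L_bal_def by (rule Greatest_le_nat[OF _ B]) (rule exI[of "good_balanced_coloring k c n", OF that])
qed

end

theory Submission
  imports Defs "HOL-Analysis.Summation_Tests"
begin

text \<open>
  Assign to every prime below \<open>p\<^sub>N\<close>, \<open>N = c (k - 1)\<close>, one of the \<open>c\<close> colors, each color being
  used at most \<open>k - 1\<close> times and color \<open>0\<close>, which also receives the number \<open>1\<close>, at most
  \<open>k - 2\<close> times. If every \<open>n > 1\<close> is given the color of one of its prime factors, then pairwise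
  coprime members of a color class have distinct prime factors of that color, so no class contains
  \<open>k\<close> of them. To balance the classes, reserve in advance for each color \<open>i\<close> a fixed finite set
  \<open>Q i\<close> of primes such that the integers without prime factor in \<open>Q i\<close> have density below
  \<open>1 / (2 c\<^sup>2)\<close>; this is possible since \<open>\<Prod> (1 - 1 / p)\<close> diverges to \<open>0\<close>. For large \<open>x\<close> at most
  \<open>x / c\<close> integers up to \<open>x\<close> miss some \<open>Q i\<close>. All others may be given any color, and so can be
  used to fill up the classes evenly. Optimality holds because \<open>1\<close> and the first \<open>N\<close> primes
  are \<open>N + 1\<close> pairwise coprime integers.
\<close>

lemma Euler_factor_pos: "prime p \<Longrightarrow> 0 < 1 - 1 / real p"
  using prime_gt_1_nat[of p] by simp

section \<open>Sieving by a finite set of primes\<close>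

definition unsieved :: "nat set \<Rightarrow> nat \<Rightarrow> nat set" where
  "unsieved Q x = {n \<in> {1..x}. \<forall>p\<in>Q. \<not> p dvd n}"

lemma finite_unsieved [simp]: "finite (unsieved Q x)"
  by (simp add: unsieved_def)

text \<open>One step of Legendre's sieve: the members of \<open>unsieved Q x\<close> divisible by
  \<open>p\<close> are exactly \<open>p\<close> times the members of
  \<open>unsieved Q (x div p)\<close>, because no prime of \<open>Q\<close> divides
  \<open>p\<close>.\<close>

lemma card_unsieved_insert:
  assumes Q: "\<forall>q\<in>Q. prime q" and p: "prime p" "p \<notin> Q"
  shows "card (unsieved (insert p Q) x) + card (unsieved Q (x div p)) = card (unsieved Q x)"
proof -
  have p0: "p > 0" using p(1) prime_gt_0_nat by blast
  have "unsieved Q x = unsieved (insert p Q) x \<union> (\<lambda>m. p * m) ` unsieved Q (x div p)"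
  proof (intro equalityI subsetI)
    fix n assume n: "n \<in> unsieved Q x"
    show "n \<in> unsieved (insert p Q) x \<union> (\<lambda>m. p * m) ` unsieved Q (x div p)"
    proof (cases "p dvd n")
      case True
      then obtain m where m: "n = p * m" by blast
      have "m \<in> unsieved Q (x div p)"
        using n m p0 by (auto simp: unsieved_def less_eq_div_iff_mult_less_eq mult.commute)
      then show ?thesis using m by blast
    qed (use n in \<open>auto simp: unsieved_def\<close>)
  next
    fix n assume "n \<in> unsieved (insert p Q) x \<union> (\<lambda>m. p * m) ` unsieved Q (x div p)"
    then show "n \<in> unsieved Q x"
    proof
      assume "n \<in> (\<lambda>m. p * m) ` unsieved Q (x div p)"
      then obtain m where m: "n = p * m" "m \<in> unsieved Q (x div p)" by blast
      have "\<not> q dvd n" if "q \<in> Q" for q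
      proof
        assume "q dvd n"
        then have "q dvd p \<or> q dvd m" using Q that m(1) prime_dvd_mult_iff by blast
        moreover have "\<not> q dvd p" using that Q p primes_dvd_imp_eq by blast
        ultimately show False using m(2) that by (auto simp: unsieved_def)
      qed
      then show ?thesis
        using m p0 by (auto simp: unsieved_def less_eq_div_iff_mult_less_eq mult.commute)
    qed (auto simp: unsieved_def)
  qed
  moreover have "unsieved (insert p Q) x \<inter> (\<lambda>m. p * m) ` unsieved Q (x div p) = {}"
    by (auto simp: unsieved_def)
  moreover have "card ((\<lambda>m. p * m) ` unsieved Q (x div p)) = card (unsieved Q (x div p))"
    using p0 by (intro card_image inj_onI) simp
  ultimately show ?thesis
    by (simp add: card_Un_disjoint)
qed

text \<open>Induction by adding one prime at a time. The bound \<open>B\<close> may depend on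
  \<open>Q\<close> in any way but not on \<open>x\<close>, which suffices because the reserved sets
  are fixed before \<open>x\<close> grows.\<close>

lemma card_unsieved_approx:
  assumes "finite Q" "\<forall>q\<in>Q. prime q"
  shows "\<exists>B. \<forall>x. \<bar>real (card (unsieved Q x)) - real x * (\<Prod>p\<in>Q. 1 - 1 / real p)\<bar> \<le> B"
  using assms
proof (induction Q rule: finite_induct)
  case empty
  have "unsieved {} x = {1..x}" for x by (auto simp: unsieved_def)
  then show ?case by (intro exI[of _ 0]) simp
next
  case (insert p Q)
  define D where "D = (\<Prod>q\<in>Q. 1 - 1 / real q)"
  obtain B where B: "\<And>x. \<bar>real (card (unsieved Q x)) - real x * D\<bar> \<le> B"
    using insert unfolding D_def by auto
  \<comment> \<open>Each of the two sieve counts contributes \<open>B\<close>; rounding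
    \<open>x / p\<close> to \<open>x div p\<close> contributes at most
    \<open>\<bar>D\<bar>\<close>.\<close>
  have "\<bar>real (card (unsieved (insert p Q) x)) - real x * ((1 - 1 / real p) * D)\<bar> \<le> 2 * B + \<bar>D\<bar>" for x
  proof -
    have eq: "real (card (unsieved (insert p Q) x))
        = real (card (unsieved Q x)) - real (card (unsieved Q (x div p)))"
      using card_unsieved_insert[of Q p x] insert by simp
    have "\<bar>real (x div p) - real x / real p\<bar> \<le> 1"
      using floor_divide_of_nat_eq[of x p, where 'a = real] by linarith
    then have "\<bar>real (x div p) - real x / real p\<bar> * \<bar>D\<bar> \<le> 1 * \<bar>D\<bar>"
      by (intro mult_right_mono) auto
    then have "\<bar>real (x div p) * D - real x / real p * D\<bar> \<le> \<bar>D\<bar>"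
      by (simp add: abs_mult[symmetric] left_diff_distrib)
    moreover have "real x * ((1 - 1 / real p) * D) = real x * D - real x / real p * D"
      by (simp add: algebra_simps)
    ultimately show ?thesis
      using B[of x] B[of "x div p"] unfolding eq by linarith
  qed
  then show ?case using insert by (auto simp: D_def)
qed

section \<open>Divergence of the Euler product\<close>

text \<open>Truncating at \<open>N\<close> turns the Euler product expansion into an inequality
  between finite sums, so no infinite series of smooth numbers is involved.\<close>

definition smooth_upto :: "nat set \<Rightarrow> nat \<Rightarrow> nat set" where
  "smooth_upto P N = {n \<in> {1..N}. \<forall>q. prime q \<longrightarrow> q dvd n \<longrightarrow> q \<in> P}"

lemma smooth_upto_empty: "smooth_upto {} N \<subseteq> {1}"
proof
  fix n assume n: "n \<in> smooth_upto {} N"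
  have "n = 1"
  proof (rule ccontr)
    assume "n \<noteq> 1"
    then obtain q where "prime q" "q dvd n" using prime_factor_nat by blast
    then show False using n by (auto simp: smooth_upto_def)
  qed
  then show "n \<in> {1}" by simp
qed

text \<open>A multiple of \<open>p\<close> in the larger set is \<open>p\<close> times another of
  its members, so its reciprocal sum H satisfies H \<le> H0 + H / p, where H0 is the sum over
  \<open>smooth_upto P N\<close>.\<close>

lemma sum_smooth_upto_insert:
  assumes p: "prime p"
  shows "(\<Sum>n\<in>smooth_upto (insert p P) N. 1 / real n) * (1 - 1 / real p)
           \<le> (\<Sum>n\<in>smooth_upto P N. 1 / real n)"
proof -
  let ?S = "smooth_upto (insert p P) N"
  have p0: "p > 0" using p prime_gt_0_nat by blast
  have fin: "finite (smooth_upto P N)" for P by (simp add: smooth_upto_def)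
  \<comment> \<open>Only an inclusion, since \<open>p * m\<close> may exceed
    \<open>N\<close>.\<close>
  have sub: "?S \<subseteq> smooth_upto P N \<union> (\<lambda>m. p * m) ` ?S"
  proof
    fix n assume n: "n \<in> ?S"
    show "n \<in> smooth_upto P N \<union> (\<lambda>m. p * m) ` ?S"
    proof (cases "p dvd n")
      case True
      then obtain m where m: "n = p * m" by blast
      have "m \<le> n" "m \<ge> 1" using m p0 n by (auto simp: smooth_upto_def)
      moreover have "n \<le> N" "\<forall>q. prime q \<longrightarrow> q dvd m \<longrightarrow> q \<in> insert p P"
        using n m by (auto simp: smooth_upto_def)
      ultimately have "m \<in> ?S" by (simp add: smooth_upto_def)
      then show ?thesis using m by blast
    next
      case False
      then show ?thesis using n by (auto simp: smooth_upto_def)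
    qed
  qed
  have "(\<Sum>n\<in>?S. 1 / real n) \<le> (\<Sum>n\<in>smooth_upto P N \<union> (\<lambda>m. p * m) ` ?S. 1 / real n)"
    using sub fin by (intro sum_mono2) auto
  also have "\<dots> \<le> (\<Sum>n\<in>smooth_upto P N. 1 / real n) + (\<Sum>n\<in>(\<lambda>m. p * m) ` ?S. 1 / real n)"
    using fin by (subst sum.union_inter[symmetric]) (auto intro!: sum_nonneg)
  also have "(\<Sum>n\<in>(\<lambda>m. p * m) ` ?S. 1 / real n) = (\<Sum>m\<in>?S. 1 / real (p * m))"
    using p0 by (subst sum.reindex) (auto intro!: inj_onI)
  also have "\<dots> = (\<Sum>m\<in>?S. 1 / real m) / real p"
    by (simp add: sum_divide_distrib mult.commute)
  finally show ?thesis by (simp add: algebra_simps)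
qed

text \<open>Truncated form of Euler's identity: without the cut at \<open>N\<close>, the reciprocals
  would sum to the inverse of the product.\<close>

lemma sum_smooth_upto_le:
  assumes "finite P" "\<forall>p\<in>P. prime p"
  shows "(\<Sum>n\<in>smooth_upto P N. 1 / real n) * (\<Prod>p\<in>P. 1 - 1 / real p) \<le> 1"
  using assms
proof (induction P rule: finite_induct)
  case empty
  have "(\<Sum>n\<in>smooth_upto {} N. 1 / real n) \<le> (\<Sum>n\<in>{1}. 1 / real n)"
    using smooth_upto_empty by (intro sum_mono2) auto
  then show ?case by simp
next
  case (insert p P)
  have nonneg: "(\<Prod>p\<in>P. 1 - 1 / real p) \<ge> 0"
    using insert.prems by (intro prod_nonneg less_imp_le[OF Euler_factor_pos] ballI) auto
  have "(\<Sum>n\<in>smooth_upto (insert p P) N. 1 / real n) * (1 - 1 / real p) * (\<Prod>p\<in>P. 1 - 1 / real p)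
     \<le> (\<Sum>n\<in>smooth_upto P N. 1 / real n) * (\<Prod>p\<in>P. 1 - 1 / real p)"
    using insert sum_smooth_upto_insert[of p P N] nonneg by (intro mult_right_mono) auto
  also have "\<dots> \<le> 1" using insert by simp
  finally show ?case using insert by (simp add: mult.assoc)
qed

lemma harmonic_sums_unbounded: "\<exists>N. (\<Sum>n=1..N. 1 / real n) > C"
proof (rule ccontr)
  assume "\<not> ?thesis"
  then have C: "(\<Sum>n=1..N. 1 / real n) \<le> C" for N by (meson not_less)
  have "summable (\<lambda>n. 1 / real (Suc n))"
  proof (rule bounded_imp_summable)
    show "(\<Sum>k\<le>n. 1 / real (Suc k)) \<le> C" for n
      using C[of "Suc n"]
      by (simp add: sum.atLeast1_atMost_eq lessThan_Suc_atMost del: of_nat_Suc sum.cl_ivl_Suc)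
  qed simp
  then have "summable (\<lambda>n. 1 / real n)" 
    using summable_Suc_iff[of "\<lambda>n. 1 / real n"] by blast
  then show False using not_summable_harmonic[where 'a = real] by (simp add: field_simps)
qed

text \<open>If \<open>P\<close> contains all primes up to \<open>N\<close>, every positive integer
  up to \<open>N\<close> is \<open>P\<close>-smooth, so the product over \<open>P\<close> is at most
  the inverse of a harmonic sum. The set \<open>E\<close> of excluded primes costs only a fixed
  factor.\<close>

lemma exists_primes_small_Euler_product:
  assumes E: "finite E" "\<forall>p\<in>E. prime p" and eps: "(\<epsilon>::real) > 0"
  shows "\<exists>Q. finite Q \<and> (\<forall>p\<in>Q. prime p) \<and> Q \<inter> E = {} \<and> (\<Prod>p\<in>Q. 1 - 1 / real p) < \<epsilon>"
proof -
  define D where "D = (\<Prod>p\<in>E. 1 - 1 / real p)"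
  have D: "D > 0" unfolding D_def
    using E by (intro prod_pos Euler_factor_pos ballI) auto
  \<comment> \<open>The factor \<open>D\<close> in the threshold pays for removing \<open>E\<close>
    from the product.\<close>
  obtain N where N: "(\<Sum>n=1..N. 1 / real n) > 1 / (D * \<epsilon>)"
    using harmonic_sums_unbounded by blast
  define P where "P = E \<union> {p. prime p \<and> p \<le> N}"
  have P: "finite P" "\<forall>p\<in>P. prime p" using E by (auto simp: P_def)
  have "smooth_upto P N = {1..N}"
    by (auto simp: smooth_upto_def P_def dest!: dvd_imp_le)
  then have "(\<Sum>n=1..N. 1 / real n) * (\<Prod>p\<in>P. 1 - 1 / real p) \<le> 1"
    using sum_smooth_upto_le[OF P, of N] by simp
  moreover have "(\<Prod>p\<in>P. 1 - 1 / real p) = D * (\<Prod>p\<in>P - E. 1 - 1 / real p)"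
    unfolding D_def using P(1) by (subst prod.subset_diff[of E P]) (auto simp: P_def)
  ultimately have le: "(\<Sum>n=1..N. 1 / real n) * (D * (\<Prod>p\<in>P - E. 1 - 1 / real p)) \<le> 1"
    by simp
  have "(\<Prod>p\<in>P - E. 1 - 1 / real p) < \<epsilon>"
  proof (rule ccontr)
    assume "\<not> ?thesis"
    then have "D * \<epsilon> \<le> D * (\<Prod>p\<in>P - E. 1 - 1 / real p)" using D by simp
    moreover have "(\<Sum>n=1..N. 1 / real n) \<ge> 0" by (intro sum_nonneg) simp
    ultimately have "(\<Sum>n=1..N. 1 / real n) * (D * \<epsilon>) \<le> 1"
      using le mult_left_mono order_trans by blast
    then show False using N D eps by (simp add: field_simps)
  qed
  then show ?thesis using P by (intro exI[of _ "P - E"]) auto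
qed

text \<open>The sets are built one after another, each avoiding the union of the earlier
  ones.\<close>

lemma exists_disjoint_primes_small_Euler_product:
  fixes m :: nat
  assumes eps: "(\<epsilon>::real) > 0"
  shows "\<exists>Q. (\<forall>i<m. finite (Q i) \<and> (\<forall>p\<in>Q i. prime p) \<and> (\<Prod>p\<in>Q i. 1 - 1 / real p) < \<epsilon>) \<and>
             (\<forall>i<m. \<forall>j<m. i \<noteq> j \<longrightarrow> Q i \<inter> Q j = {})"
proof (induction m)
  case 0
  show ?case by simp
next
  case (Suc m)
  then obtain Q where
    Q: "\<forall>i<m. finite (Q i) \<and> (\<forall>p\<in>Q i. prime p) \<and> (\<Prod>p\<in>Q i. 1 - 1 / real p) < \<epsilon>"
       "\<forall>i<m. \<forall>j<m. i \<noteq> j \<longrightarrow> Q i \<inter> Q j = {}"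
    by blast
  have "finite (\<Union>i<m. Q i)" "\<forall>p\<in>(\<Union>i<m. Q i). prime p" using Q by auto
  from exists_primes_small_Euler_product[OF this eps] obtain R where
    R: "finite R" "\<forall>p\<in>R. prime p" "R \<inter> (\<Union>i<m. Q i) = {}" "(\<Prod>p\<in>R. 1 - 1 / real p) < \<epsilon>"
    by blast
  have "R \<inter> Q i = {}" if "i < m" for i using R(3) that by blast
  then show ?case
    using Q R by (intro exI[of _ "Q(m := R)"]) (auto simp: less_Suc_eq Int_commute)
qed

section \<open>Colorings\<close>

lemma card_eq_sum_color_classes:
  assumes "finite A" "h ` A \<subseteq> {..<c::nat}"
  shows "(\<Sum>i<c. card {a \<in> A. h a = i}) = card A"
  using sum.group[OF assms(1) _ assms(2), of "\<lambda>_. 1::nat"] by simp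

text \<open>Greedy extension: while some element is uncolored, fewer than \<open>card A\<close>
  places are taken, so some color still has room. It serves twice, for coloring the primes and for
  balancing the integers.\<close>

lemma extend_coloring_with_capacities:
  fixes cap :: "nat \<Rightarrow> nat"
  assumes "finite A" "B \<subseteq> A" "g ` B \<subseteq> {..<c}"
    and "\<forall>i<c. card {a \<in> B. g a = i} \<le> cap i"
    and "card A \<le> (\<Sum>i<c. cap i)"
  shows "\<exists>h. h ` A \<subseteq> {..<c} \<and> (\<forall>a\<in>B. h a = g a) \<and> (\<forall>i<c. card {a \<in> A. h a = i} \<le> cap i)"
  using assms(2-4)
proof (induction "card (A - B)" arbitrary: B g)
  case 0
  then have "A = B" using assms(1) by auto
  then show ?case using 0 by blast
next
  case (Suc m)
  have finB: "finite B" using Suc.prems(1) assms(1) finite_subset by blast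
  obtain a where a: "a \<in> A" "a \<notin> B"
    using Suc.hyps(2) by (metis DiffE card.empty ex_in_conv nat.distinct(1))
  have "card B < card A" using a Suc.prems(1) assms(1) by (intro psubset_card_mono) auto
  then have "(\<Sum>i<c. card {b \<in> B. g b = i}) < (\<Sum>i<c. cap i)"
    using card_eq_sum_color_classes[OF finB Suc.prems(2)] assms(5) by linarith
  then obtain i where i: "i < c" "card {b \<in> B. g b = i} < cap i"
    by (metis (mono_tags, lifting) lessThan_iff linorder_not_less sum_mono)
  define g' where "g' = g(a := i)"
  have cls: "{b \<in> insert a B. g' b = j} = (if j = i then insert a {b \<in> B. g b = i} else {b \<in> B. g b = j})"
    for j using a by (auto simp: g'_def)
  have "A - insert a B = (A - B) - {a}" by blast
  then have "m = card (A - insert a B)" using Suc.hyps(2) a by simp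
  moreover have "insert a B \<subseteq> A" "g' ` insert a B \<subseteq> {..<c}"
    using a i Suc.prems by (auto simp: g'_def)
  moreover have "\<forall>j<c. card {b \<in> insert a B. g' b = j} \<le> cap j"
    using Suc.prems(3) i finB a unfolding cls by auto
  ultimately obtain h where h: "h ` A \<subseteq> {..<c}" "\<forall>b\<in>insert a B. h b = g' b"
      "\<forall>j<c. card {b \<in> A. h b = j} \<le> cap j"
    using Suc.hyps(1) by blast
  moreover have "\<forall>b\<in>B. h b = g b" using h(2) a by (auto simp: g'_def)
  ultimately show ?case by blast
qed

text \<open>Choosing for each member a prime factor in \<open>P\<close> is injective, as a shared
  choice would divide the gcd.\<close>

lemma card_pairwise_coprime_le:
  assumes "finite P" and cop: "\<forall>a\<in>S. \<forall>b\<in>S. a \<noteq> b \<longrightarrow> gcd a b = (1::nat)"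
    and pf: "\<forall>a\<in>S. \<exists>p\<in>P. prime p \<and> p dvd a"
  shows "card S \<le> card P"
proof -
  obtain r where r: "\<And>a. a \<in> S \<Longrightarrow> r a \<in> P \<and> prime (r a) \<and> r a dvd a"
    using pf by metis
  have "inj_on r S"
  proof (rule inj_onI, rule ccontr)
    fix a b assume ab: "a \<in> S" "b \<in> S" "r a = r b" "a \<noteq> b"
    then have "r a dvd gcd a b" using r by (metis gcd_greatest)
    then have "r a dvd 1" using cop ab by auto
    then show False using r ab not_prime_unit by blast
  qed
  moreover have "r ` S \<subseteq> P" using r by blast
  ultimately show ?thesis using card_inj_on_le assms(1) by blast
qed

text \<open>Upper bounds suffice: the capacities sum to exactly \<open>n\<close>, so every class
  attains its own.\<close>

lemma balanced_coloringI:
  assumes c: "c > 0" and f: "f ` {1..n} \<subseteq> {..<c}"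
    and le: "\<forall>i<c. card (color_class f n i) \<le> n div c + (if i < n mod c then 1 else 0)"
  shows "balanced_coloring c n f"
proof -
  let ?cap = "\<lambda>i. n div c + (if i < n mod c then 1 else 0)"
  have "{i. i < c \<and> i < n mod c} = {..<n mod c}"
    using c mod_less_divisor[of c n] by (auto simp del: mod_less_divisor)
  then have "(\<Sum>i<c. ?cap i) = n"
    by (simp add: sum.distrib sum.If_cases lessThan_def Int_def)
  moreover have "(\<Sum>i<c. card (color_class f n i)) = n"
    using card_eq_sum_color_classes[OF _ f] by (simp add: color_class_def)
  ultimately have eq: "card (color_class f n i) = ?cap i" if "i < c" for i
    using sum_mono_inv[of "\<lambda>i. card (color_class f n i)" "{..<c}" ?cap i] le that by auto
  have fl: "\<lfloor>real n / real c\<rfloor> = int (n div c)" by (simp add: floor_divide_of_nat_eq)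
  have ce: "\<lceil>real n / real c\<rceil> = int (n div c) + 1" if "n mod c > 0"
  proof -
    have "\<not> c dvd n" using that by (auto simp: dvd_eq_mod_eq_0)
    then have "real n / real c \<noteq> of_int \<lfloor>real n / real c\<rfloor>"
      using c unfolding fl by (auto simp: field_simps simp flip: of_nat_mult) (metis dvd_triv_left)
    then show ?thesis using fl ceiling_altdef[of "real n / real c"] by auto
  qed
  have "int (card (color_class f n i)) \<in> {\<lfloor>real n / real c\<rfloor>, \<lceil>real n / real c\<rceil>}" if "i < c" for i
    using eq[OF that] fl ce by auto
  then show ?thesis using f unfolding balanced_coloring_def by blast
qed

section \<open>Primes below the \<open>N\<close>-th prime\<close>

lemma primes_less_nth_prime:
  "{p. prime p \<and> p < nth_prime N} = enumerate {p. prime p} ` {..<N - 1}"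
proof (intro equalityI subsetI)
  fix p :: nat assume p: "p \<in> {p. prime p \<and> p < nth_prime N}"
  then obtain m where m: "p = enumerate {p. prime p} m"
    using enumerate_Ex[of "{p. prime p}" p] primes_infinite by auto
  then have "m < N - 1"
    using p primes_infinite by (simp add: nth_prime_def)
  then show "p \<in> enumerate {p. prime p} ` {..<N - 1}" using m by blast
next
  fix p :: nat assume "p \<in> enumerate {p. prime p} ` {..<N - 1}"
  then show "p \<in> {p. prime p \<and> p < nth_prime N}"
    using primes_infinite enumerate_in_set[OF primes_infinite]
    by (auto simp: nth_prime_def)
qed

lemma card_primes_less_nth_prime: "card {p. prime p \<and> p < nth_prime N} = N - 1"
  unfolding primes_less_nth_prime
  using card_image[OF inj_enumerate[OF primes_infinite, THEN inj_on_subset]] by simp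

lemma prime_nth_prime: "prime (nth_prime N)"
  using enumerate_in_set[OF primes_infinite] by (simp add: nth_prime_def)

text \<open>A crude growth bound, enough to push the \<open>N\<close>-th prime past any fixed
  threshold.\<close>

lemma nth_prime_ge: "N - 1 \<le> nth_prime N"
  by (simp add: nth_prime_def le_enumerate primes_infinite)

text \<open>Pigeonhole: \<open>c * (k - 1) + 1\<close> pairwise coprime integers in \<open>c\<close>
  classes put at least \<open>k\<close> into one class.\<close>

lemma good_balanced_coloring_less:
  assumes k: "k \<ge> 2" and c: "c > 0" and f: "good_balanced_coloring k c n f"
  shows "n < nth_prime (c * (k - 1))"
proof (rule ccontr)
  assume n: "\<not> ?thesis"
  define N where "N = c * (k - 1)"
  \<comment> \<open>For \<open>N = 0\<close> the truncated \<open>N - 1\<close> would spoil the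
    count of \<open>T\<close> below.\<close>
  have N: "N \<ge> 1" using k c by (simp add: N_def)
  define P where "P = {p. prime p \<and> p < nth_prime N}"
  define T where "T = insert 1 (insert (nth_prime N) P)"
  have finP: "finite P" by (simp add: P_def)
  have T1: "T \<subseteq> {1..n}"
  proof
    fix a assume "a \<in> T"
    then have "(a = 1 \<or> prime a) \<and> a \<le> nth_prime N"
      using prime_nth_prime[of N] prime_ge_1_nat[of "nth_prime N"] by (auto simp: T_def P_def)
    then show "a \<in> {1..n}" using n prime_ge_1_nat[of a] by (auto simp: N_def)
  qed
  have cardT: "card T = Suc N"
  proof -
    have "nth_prime N \<notin> P" "1 \<notin> insert (nth_prime N) P"
      using prime_gt_1_nat[OF prime_nth_prime[of N]] by (auto simp: P_def)
    moreover have "card P = N - 1" by (simp add: P_def card_primes_less_nth_prime)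
    ultimately show ?thesis using finP N by (simp add: T_def)
  qed
  have copT: "gcd a b = 1" if "a \<in> T" "b \<in> T" "a \<noteq> b" for a b
  proof -
    have "a = 1 \<or> prime a" "b = 1 \<or> prime b"
      using that prime_nth_prime by (auto simp: T_def P_def)
    then show ?thesis
      using primes_coprime[of a b] that(3) coprime_iff_gcd_eq_1 by auto
  qed
  have "f ` T \<subseteq> {..<c}"
    using f T1 unfolding good_balanced_coloring_def balanced_coloring_def by blast
  then have sum: "(\<Sum>i<c. card {a \<in> T. f a = i}) = Suc N"
    using card_eq_sum_color_classes[of T f c] cardT finP by (simp add: T_def)
  have "card {a \<in> T. f a = i} \<le> k - 1" if i: "i < c" for i
  proof (rule ccontr)
    assume "\<not> ?thesis"
    then have "k \<le> card {a \<in> T. f a = i}" by simp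
    then obtain S where S: "S \<subseteq> {a \<in> T. f a = i}" "card S = k" "finite S"
      by (rule obtain_subset_with_card_n)
    have "S \<subseteq> color_class f n i" using S(1) T1 by (auto simp: color_class_def)
    moreover have "\<forall>a\<in>S. \<forall>b\<in>S. a \<noteq> b \<longrightarrow> gcd a b = 1" using S(1) copT by blast
    ultimately have "contains_pairwise_coprime (color_class f n i) k"
      unfolding contains_pairwise_coprime_def using S by blast
    then show False using f i unfolding good_balanced_coloring_def by blast
  qed
  then have "(\<Sum>i<c. card {a \<in> T. f a = i}) \<le> N"
    using sum_bounded_above[of "{..<c}" "\<lambda>i. card {a \<in> T. f a = i}" "k - 1"] by (simp add: N_def)
  then show False using sum by simp
qed

section \<open>The balanced coloring\<close>

lemma exists_reserved_primes:
  assumes c: "c > 0"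
  shows "\<exists>Q X. (\<forall>i<c. finite (Q i) \<and> (\<forall>p\<in>Q i. prime p)) \<and>
           (\<forall>i<c. \<forall>j<c. i \<noteq> j \<longrightarrow> Q i \<inter> Q j = {}) \<and>
           (\<forall>x\<ge>X. card (\<Union>i<c. unsieved (Q i) x) \<le> x div c)"
proof -
  \<comment> \<open>The \<open>c\<close> main terms then add up to at most
    \<open>x / (2 * c)\<close>, half of the target \<open>x / c\<close>.\<close>
  define \<epsilon> where "\<epsilon> = 1 / (2 * real c ^ 2)"
  have "\<epsilon> > 0" using c by (simp add: \<epsilon>_def)
  from exists_disjoint_primes_small_Euler_product[OF this, of c] obtain Q where
    Q: "\<forall>i<c. finite (Q i) \<and> (\<forall>p\<in>Q i. prime p) \<and> (\<Prod>p\<in>Q i. 1 - 1 / real p) < \<epsilon>"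
       "\<forall>i<c. \<forall>j<c. i \<noteq> j \<longrightarrow> Q i \<inter> Q j = {}"
    by blast
  have "\<forall>i<c. \<exists>B. \<forall>x. \<bar>real (card (unsieved (Q i) x)) - real x * (\<Prod>p\<in>Q i. 1 - 1 / real p)\<bar> \<le> B"
    using Q(1) by (intro allI impI card_unsieved_approx) auto
  then obtain B where B: "\<And>i x. i < c \<Longrightarrow>
      \<bar>real (card (unsieved (Q i) x)) - real x * (\<Prod>p\<in>Q i. 1 - 1 / real p)\<bar> \<le> B i"
    by metis
  define B' where "B' = (\<Sum>i<c. B i)"
  \<comment> \<open>For such \<open>x\<close> the other half of \<open>x / c\<close> is at least
    \<open>B' + 1\<close>: it absorbs the total sieve error and the rounding down to
    \<open>x div c\<close>.\<close>
  have "card (\<Union>i<c. unsieved (Q i) x) \<le> x div c" if x: "x \<ge> nat \<lceil>2 * real c * (B' + 1)\<rceil>" for x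
  proof -
    have "real (card (unsieved (Q i) x)) \<le> real x * \<epsilon> + B i" if "i < c" for i
    proof -
      have "real x * (\<Prod>p\<in>Q i. 1 - 1 / real p) \<le> real x * \<epsilon>"
        using Q(1) that by (intro mult_left_mono) (auto intro: less_imp_le)
      then show ?thesis using B[OF that, of x] by linarith
    qed
    then have "(\<Sum>i<c. real (card (unsieved (Q i) x))) \<le> (\<Sum>i<c. real x * \<epsilon> + B i)"
      by (intro sum_mono) auto
    also have "\<dots> = real c * (real x * \<epsilon>) + B'" by (simp add: sum.distrib B'_def)
    also have "\<dots> = real x / (2 * real c) + B'" using c by (simp add: \<epsilon>_def power2_eq_square)
    also have "\<dots> \<le> real x / real c - 1"
    proof -
      have "2 * real c * (B' + 1) \<le> real x" using x by linarith
      then have "B' + 1 \<le> real x / (2 * real c)" using c by (simp add: field_simps)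
      moreover have "real x / real c = real x / (2 * real c) + real x / (2 * real c)" by simp
      ultimately show ?thesis by linarith
    qed
    also have "\<dots> \<le> real (x div c)"
      using floor_divide_of_nat_eq[of x c, where 'a = real] by linarith
    finally have "(\<Sum>i<c. card (unsieved (Q i) x)) \<le> x div c"
      by (simp flip: of_nat_sum)
    moreover have "card (\<Union>i<c. unsieved (Q i) x) \<le> (\<Sum>i<c. card (unsieved (Q i) x))"
      by (rule card_UN_le) simp
    ultimately show ?thesis by linarith
  qed
  then show ?thesis using Q by blast
qed

text \<open>The combinatorial core for fixed \<open>k\<close> and \<open>x\<close>; the asymptotic
  input enters only through the assumptions on \<open>Q\<close>.\<close>

lemma good_balanced_coloring_from_reserved_primes:
  assumes c: "c > 0" and k: "k \<ge> 2"
    and x: "x < nth_prime (c * (k - 1))"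
    and prime: "\<forall>i<c. \<forall>p\<in>Q i. prime p \<and> p < nth_prime (c * (k - 1))"
    and card: "\<forall>i<c. card (Q i) \<le> k - 2"
    and disj: "\<forall>i<c. \<forall>j<c. i \<noteq> j \<longrightarrow> Q i \<inter> Q j = {}"
    and small: "card (\<Union>i<c. unsieved (Q i) x) \<le> x div c"
  shows "\<exists>f. good_balanced_coloring k c x f"
proof -
  define N where "N = c * (k - 1)"
  define P where "P = {p. prime p \<and> p < nth_prime N}"
  have finP: "finite P" by (simp add: P_def)
  define R where "R = (\<Union>i<c. Q i)"
  define g where "g p = (THE i. i < c \<and> p \<in> Q i)" for p
  have g: "g p = i" if "i < c" "p \<in> Q i" for p i
    unfolding g_def using that disj by (intro the_equality) blast+
  \<comment> \<open>Color \<open>0\<close> gives up one place to the number 1, which has no prime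
    factor.\<close>
  define cap where "cap i = (if i = 0 then k - 2 else k - 1)" for i :: nat
  have "\<exists>h. h ` P \<subseteq> {..<c} \<and> (\<forall>p\<in>R. h p = g p) \<and> (\<forall>i<c. card {p \<in> P. h p = i} \<le> cap i)"
  proof (rule extend_coloring_with_capacities[OF finP])
    show "R \<subseteq> P" using prime by (auto simp: R_def P_def N_def)
    show "g ` R \<subseteq> {..<c}" using g by (auto simp: R_def)
    have "{p \<in> R. g p = i} = Q i" if "i < c" for i using g that by (auto simp: R_def)
    then show "\<forall>i<c. card {p \<in> R. g p = i} \<le> cap i" using card by (fastforce simp: cap_def)
    \<comment> \<open>The capacities total \<open>N - 1\<close>, exactly the number of primes below
      the \<open>N\<close>-th one.\<close>
    obtain c' where c': "c = Suc c'" using c gr0_conv_Suc by blast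
    have "(\<Sum>i<c. cap i) = (k - 2) + c' * (k - 1)"
      unfolding c' by (subst sum.lessThan_Suc_shift) (simp add: cap_def)
    then show "card P \<le> (\<Sum>i<c. cap i)"
      using k by (simp add: P_def card_primes_less_nth_prime N_def c')
  qed
  then obtain h where h: "h ` P \<subseteq> {..<c}" "\<forall>p\<in>R. h p = g p"
      "\<forall>i<c. card {p \<in> P. h p = i} \<le> cap i"
    by blast
  have hQ: "h p = i" if "i < c" "p \<in> Q i" for p i
    using h(2) g that by (auto simp: R_def)
  define r where "r n = (SOME p. prime p \<and> p dvd n)" for n :: nat
  have r: "prime (r n)" "r n dvd n" if "n \<noteq> 1" for n
    using someI_ex[of "\<lambda>p. prime p \<and> p dvd n"] prime_factor_nat[OF that] by (auto simp: r_def)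
  have inP: "p \<in> P" if "prime p" "p dvd n" "n \<in> {1..x}" for p n
    using that x dvd_imp_le[of p n] by (auto simp: P_def N_def)
  \<comment> \<open>These integers miss some reserved set, so their color is forced through
    \<open>u\<close>; all others are free.\<close>
  define U where "U = (\<Union>i<c. unsieved (Q i) x)"
  define u where "u n = (if n = 1 then 0 else h (r n))" for n
  have Ux: "U \<subseteq> {1..x}" by (auto simp: U_def unsieved_def)
  have finU: "finite U" by (simp add: U_def)
  have "\<exists>f. f ` {1..x} \<subseteq> {..<c} \<and> (\<forall>n\<in>U. f n = u n) \<and>
      (\<forall>i<c. card {n \<in> {1..x}. f n = i} \<le> x div c + (if i < x mod c then 1 else 0))"
  proof (rule extend_coloring_with_capacities[OF _ Ux])
    show "u ` U \<subseteq> {..<c}"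
    proof
      fix i assume "i \<in> u ` U"
      then obtain n where n: "n \<in> U" "i = u n" by blast
      then show "i \<in> {..<c}"
        using c h(1) inP[OF r, of n] subsetD[OF Ux n(1)] by (auto simp: u_def)
    qed
    \<comment> \<open>All of \<open>U\<close> fits into a single class, so the distribution of the
      forced colors does not matter.\<close>
    have "card {n \<in> U. u n = i} \<le> x div c" for i
      using card_mono[OF finU, of "{n \<in> U. u n = i}"] small unfolding U_def by fastforce
    then show "\<forall>i<c. card {n \<in> U. u n = i} \<le> x div c + (if i < x mod c then 1 else 0)"
      using trans_le_add1 by blast
    have "{i. i < c \<and> i < x mod c} = {..<x mod c}"
      using c mod_less_divisor[of c x] by (auto simp del: mod_less_divisor)
    then have "(\<Sum>i<c. x div c + (if i < x mod c then 1 else 0)) = x"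
      by (simp add: sum.distrib sum.If_cases lessThan_def Int_def)
    then show "card {1..x} \<le> (\<Sum>i<c. x div c + (if i < x mod c then 1 else 0))" by simp
  qed simp
  then obtain f where f: "f ` {1..x} \<subseteq> {..<c}" "\<forall>n\<in>U. f n = u n"
      "\<forall>i<c. card {n \<in> {1..x}. f n = i} \<le> x div c + (if i < x mod c then 1 else 0)"
    by blast
  have bal: "balanced_coloring c x f"
    using balanced_coloringI[OF c f(1)] f(3) by (simp add: color_class_def)
  \<comment> \<open>The key invariant. Outside \<open>U\<close> it holds whatever color the
    balancing chose, because \<open>n\<close> has a prime factor in every reserved set.\<close>
  have factor: "\<exists>p\<in>{p \<in> P. h p = f n}. prime p \<and> p dvd n" if n: "n \<in> {1..x}" "n \<noteq> 1" for n
  proof (cases "n \<in> U")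
    case True
    then have "h (r n) = f n" using f(2) n by (simp add: u_def)
    then show ?thesis using r[OF n(2)] inP[OF r[OF n(2)] n(1)] by blast
  next
    case False
    have "f n < c" using f(1) n by blast
    then have "\<exists>p\<in>Q (f n). p dvd n" using False n by (auto simp: U_def unsieved_def)
    then obtain p where p: "p \<in> Q (f n)" "p dvd n" by blast
    then have "prime p" "h p = f n" using prime hQ \<open>f n < c\<close> by blast+
    then show ?thesis using p inP n by blast
  qed
  have one: "f 1 = 0" if "1 \<le> x"
  proof -
    \<comment> \<open>No prime divides 1, so 1 lies in \<open>U\<close> and its color is
      forced.\<close>
    have "1 \<in> unsieved (Q 0) x"
      using that prime c by (auto simp: unsieved_def dest!: spec[of _ "0::nat"])
    then have "1 \<in> U" using c by (auto simp: U_def)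
    then show ?thesis using f(2) by (simp add: u_def)
  qed
  have "\<not> contains_pairwise_coprime (color_class f x i) k" if i: "i < c" for i
  proof
    assume "contains_pairwise_coprime (color_class f x i) k"
    then obtain S where S: "S \<subseteq> color_class f x i" "finite S" "card S = k"
        "\<forall>a\<in>S. \<forall>b\<in>S. a \<noteq> b \<longrightarrow> gcd a b = 1"
      unfolding contains_pairwise_coprime_def by blast
    have "\<forall>a\<in>S - {1}. \<exists>p\<in>{p \<in> P. h p = i}. prime p \<and> p dvd a"
      using factor S(1) unfolding color_class_def by blast
    then have le: "card (S - {1}) \<le> card {p \<in> P. h p = i}"
      using S(4) finP by (intro card_pairwise_coprime_le) auto
    show False
    \<comment> \<open>If 1 is in \<open>S\<close>, the other \<open>k - 1\<close> members need
      distinct primes of color \<open>0\<close>, but only \<open>k - 2\<close> are available;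
      otherwise \<open>k\<close> members compete for at most \<open>k - 1\<close> primes.\<close>
    proof (cases "1 \<in> S")
      case True
      then have "i = 0" using S(1) one by (auto simp: color_class_def)
      then have "card (S - {1}) \<le> k - 2" using le h(3) i by (auto simp: cap_def)
      then show False using True S(2,3) k by simp
    next
      case False
      then have "k \<le> cap i" using le h(3) i S(3) by fastforce
      then show False using k by (auto simp: cap_def split: if_splits)
    qed
  qed
  then show ?thesis using bal unfolding good_balanced_coloring_def by blast
qed

lemma eventually_good_balanced_coloring:
  assumes c: "c \<ge> 2"
  shows "\<exists>K. \<forall>k\<ge>K. \<exists>f. good_balanced_coloring k c (nth_prime (c * (k - 1)) - 1) f"
proof -
  have c0: "c > 0" using c by simp
  obtain Q X where Q: "\<forall>i<c. finite (Q i) \<and> (\<forall>p\<in>Q i. prime p)"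
      "\<forall>i<c. \<forall>j<c. i \<noteq> j \<longrightarrow> Q i \<inter> Q j = {}"
      "\<And>x. x \<ge> X \<Longrightarrow> card (\<Union>i<c. unsieved (Q i) x) \<le> x div c"
    using exists_reserved_primes[OF c0] by blast
  have "finite (\<Union>i<c. Q i)" using Q(1) by auto
  then obtain D where D: "\<And>i p. i < c \<Longrightarrow> p \<in> Q i \<Longrightarrow> p < D"
    unfolding finite_nat_set_iff_bounded by blast
  \<comment> \<open>\<open>D\<close> bounds both the reserved primes and the size of each
    \<open>Q i\<close>; \<open>X\<close> is the sieve threshold. As \<open>c\<close> is at least 2,
    the prime in question is at least \<open>2 * k - 3\<close>, hence above
    \<open>D + X\<close>.\<close>
  have "\<exists>f. good_balanced_coloring k c (nth_prime (c * (k - 1)) - 1) f" if k: "k \<ge> D + X + 4" for k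
  proof -
    have "2 * (k - 1) \<le> c * (k - 1)" using c by (rule mult_le_mono1)
    then have big: "nth_prime (c * (k - 1)) > D + X"
      using nth_prime_ge[of "c * (k - 1)"] k by linarith
    have "card (Q i) \<le> k - 2" if "i < c" for i
    proof -
      have "Q i \<subseteq> {..<D}" using D that by blast
      then have "card (Q i) \<le> D" using card_mono[of "{..<D}" "Q i"] by simp
      then show ?thesis using k by linarith
    qed
    moreover have "\<forall>i<c. \<forall>p\<in>Q i. prime p \<and> p < nth_prime (c * (k - 1))"
    proof (intro allI impI ballI)
      fix i p assume ip: "i < c" "p \<in> Q i"
      then have "p < D" by (rule D)
      then show "prime p \<and> p < nth_prime (c * (k - 1))" using ip Q(1) big by auto
    qed
    moreover have "card (\<Union>i<c. unsieved (Q i) (nth_prime (c * (k - 1)) - 1))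
        \<le> (nth_prime (c * (k - 1)) - 1) div c"
      using big by (intro Q(3)) linarith
    ultimately show ?thesis
      using k big c0 Q(2) by (intro good_balanced_coloring_from_reserved_primes[where Q = Q]) auto
  qed
  then show ?thesis by blast
qed

theorem theorem7p1:
  fixes c :: nat
  assumes "c \<ge> 2"
  shows "(\<exists>K. \<forall>k\<ge>K. \<exists>f. good_balanced_coloring k c (nth_prime (c * (k - 1)) - 1) f) \<and>
         (\<exists>K. \<forall>k\<ge>K. L_bal k c = nth_prime (c * (k - 1)) - 1)"
proof -
  obtain K where K: "\<And>k. k \<ge> K \<Longrightarrow> \<exists>f. good_balanced_coloring k c (nth_prime (c * (k - 1)) - 1) f"
    using eventually_good_balanced_coloring[OF assms] by blast
  \<comment> \<open>The 2 is the requirement of the upper bound; it also ensures that the maximum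
    exists.\<close>
  have "L_bal k c = nth_prime (c * (k - 1)) - 1" if k: "k \<ge> max K 2" for k
  proof (rule antisym)
    obtain f where "good_balanced_coloring k c (L_bal k c) f"
      using L_bal_greatest(1)[of k c] k by auto
    then have "L_bal k c < nth_prime (c * (k - 1))"
      using good_balanced_coloring_less k assms by auto
    then show "L_bal k c \<le> nth_prime (c * (k - 1)) - 1" by linarith
    show "nth_prime (c * (k - 1)) - 1 \<le> L_bal k c"
      using K[of k] L_bal_greatest(2)[of k c] k by auto
  qed
  then show ?thesis using K by blast
qed

end
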